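(* Let $R$ be a finite commutative ring with unity and let $\Gamma'^{c}(R)$ be the complement unity product graph associated with $R$. Suppose that $\Gamma'^{c}(R)$ is not a complete graph. Then the following hold: (1) $diam(\Gamma'^{c}(R))=2$; (2) $rad(\Gamma'^{c}(R))=1$.
   Context: For a ring $R$ with unity $e$, let $U(R)$ denote the set of units of $R$. The complement unity product graph $\Gamma'^{c}(R)$ is the simple graph with vertex set $U(R)$ in which two distinct vertices $r_i,r_j$ are adjacent if and only if $r_i\cdot r_j\neq e$. A graph is complete if every two distinct vertices are adjacent. The distance between two vertices is the length of a shortest path between them ($\infty$ if there is none). The eccentricity of a vertex is the maximum of its distances to all other vertices; the diameter $diam(\Gamma)$ is the maximum, and the radius $rad(\Gamma)$ the minimum, of the eccentricities of all vertices of $\Gamma$. *)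

theory Defs
  imports "HOL-Algebra.Ring" "HOL-Library.Extended_Nat" "Graph_Theory.Graph_Theory"
begin

text \<open>As in the Graph_Theory entry, an undirected simple graph is a symmetric loop-free digraph:
  an edge between \<open>u\<close> and \<open>v\<close> is represented by the two arcs \<open>(u, v)\<close> and \<open>(v, u)\<close>.\<close>

definition unity_product_graph_compl :: "('a, 'b) ring_scheme \<Rightarrow> ('a, 'a \<times> 'a) pre_digraph" where
  "unity_product_graph_compl R = with_proj
     \<lparr> pverts = Units R,
       parcs = {(r, s). r \<in> Units R \<and> s \<in> Units R \<and> r \<noteq> s \<and> r \<otimes>\<^bsub>R\<^esub> s \<noteq> \<one>\<^bsub>R\<^esub>} \<rparr>"

definition complete_graph :: "('a, 'b) pre_digraph \<Rightarrow> bool" where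
  "complete_graph G \<longleftrightarrow> (\<forall>u \<in> verts G. \<forall>v \<in> verts G. u \<noteq> v \<longrightarrow> u \<rightarrow>\<^bsub>G\<^esub> v)"

text \<open>The infimum over the empty set is \<open>\<infinity>\<close>, which is the distance of two vertices not
  joined by a path.\<close>

definition graph_dist :: "('a, 'b) pre_digraph \<Rightarrow> 'a \<Rightarrow> 'a \<Rightarrow> enat" where
  "graph_dist G u v = (INF p \<in> {p. pre_digraph.apath G u p v}. enat (length p))"

text \<open>On a finite nonempty index set, \<open>SUP\<close> and \<open>INF\<close> below are the maximum and the minimum.
  The eccentricity of the only vertex of a one-vertex graph is \<open>Sup {} = 0\<close>.\<close>

definition eccentricity :: "('a, 'b) pre_digraph \<Rightarrow> 'a \<Rightarrow> enat" where
  "eccentricity G u = (SUP v \<in> verts G - {u}. graph_dist G u v)"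

definition graph_diam :: "('a, 'b) pre_digraph \<Rightarrow> enat" where
  "graph_diam G = (SUP u \<in> verts G. eccentricity G u)"

definition graph_rad :: "('a, 'b) pre_digraph \<Rightarrow> enat" where
  "graph_rad G = (INF u \<in> verts G. eccentricity G u)"

text \<open>The following facts relate these definitions to the notions of the Graph_Theory entry.\<close>

lemma graph_unity_product_graph_compl:
  assumes "cring R" "finite (carrier R)"
  shows "graph (unity_product_graph_compl R)"
proof -
  interpret cring R by fact
  have fin: "finite (Units R)"
    using assms(2) by (rule finite_subset[rotated]) (auto simp: Units_def)
  have "finite {(r, s). r \<in> Units R \<and> s \<in> Units R \<and> r \<noteq> s \<and> r \<otimes>\<^bsub>R\<^esub> s \<noteq> \<one>\<^bsub>R\<^esub>}"
    by (rule finite_subset[of _ "Units R \<times> Units R"]) (use fin in auto)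
  then have "pair_graph \<lparr> pverts = Units R,
      parcs = {(r, s). r \<in> Units R \<and> s \<in> Units R \<and> r \<noteq> s \<and> r \<otimes>\<^bsub>R\<^esub> s \<noteq> \<one>\<^bsub>R\<^esub>} \<rparr>"
    using fin by unfold_locales (auto simp: symmetric_def sym_def m_comm Units_closed)
  then show ?thesis
    unfolding unity_product_graph_compl_def by (rule pair_graph.pair_graphD_graph)
qed

lemma complete_graph_iff_complete_digraph:
  assumes "graph G"
  shows "complete_graph G \<longleftrightarrow> (\<exists>n. complete_digraph n G)"
proof -
  interpret graph G by fact
  have "arcs_ends G \<subseteq> {(u, v). (u, v) \<in> verts G \<times> verts G \<and> u \<noteq> v}"
    using adj_not_same by (auto dest: adj_in_verts)
  then show ?thesis
    using assms unfolding complete_graph_def complete_digraph_def by auto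
qed

lemma (in wf_digraph) graph_dist_eq_unit_cost:
  "ereal_of_enat (graph_dist G u v) = \<mu> (\<lambda>_. 1) u v"
proof -
  have cost: "awalk_cost (\<lambda>_. 1) p = real (length p)" for p :: "'b list"
    by (induct p) auto
  show ?thesis
  proof (cases "u \<rightarrow>\<^sup>* v")
    case True
    then obtain p0 where p0: "apath u p0 v"
      by (auto simp: reachable_apath)
    define S where "S = {p. apath u p v}"
    have "(INF p \<in> S. enat (length p)) \<in> (\<lambda>p. enat (length p)) ` S"
      using p0 by (intro wellorder_InfI[of "enat (length p0)"]) (auto simp: S_def)
    then obtain p where p: "apath u p v" "graph_dist G u v = enat (length p)"
      by (auto simp: graph_dist_def S_def)
    have min: "length p \<le> length q" if "awalk u q v" for q
      using that
    proof (induct rule: awalk_to_apath_induct)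
      case (path q)
      then have "graph_dist G u v \<le> enat (length q)"
        unfolding graph_dist_def by (intro INF_lower) (auto simp: apath_def)
      then show ?case using p by simp
    next
      case (decomp q q1 r q2)
      then show ?case by (auto elim!: awalk_cyc_decompE)
    qed
    have "\<mu> (\<lambda>_. 1) u v = ereal (real (length p))"
      unfolding \<mu>_def cost
      by (rule INF_eqI) (use min p in \<open>auto simp: apath_def\<close>)
    then show ?thesis using p by simp
  next
    case False
    then have "graph_dist G u v = \<infinity>"
      by (auto simp: graph_dist_def reachable_apath top_enat_def)
    then show ?thesis using False by (simp add: shortest_path_inf)
  qed
qed

end

theory Submission
  imports Defs
begin

text \<open>The unit \<open>\<one>\<close> is adjacent to every other unit \<open>r\<close>, because
  \<open>\<one> \<otimes> r = r \<noteq> \<one>\<close>. Everything else is a fact about an arbitrary undirected graph with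
  such a universal vertex \<open>c\<close> that is not complete. A missing edge provides a second vertex, so
  \<open>c\<close> has eccentricity exactly \<open>1\<close>, and no vertex has a smaller one; hence the radius is \<open>1\<close>. Any
  two vertices are joined by a path of length at most \<open>2\<close> through \<open>c\<close>, and the ends of the missing
  edge are not joined by a shorter one; hence the diameter is \<open>2\<close>.\<close>

context wf_digraph
begin

lemma graph_dist_ge_1:
  assumes "u \<noteq> v"
  shows "1 \<le> graph_dist G u v"
  unfolding graph_dist_def
proof (rule INF_greatest)
  fix p assume "p \<in> {p. apath u p v}"
  then have "p \<noteq> []"
    using assms by (auto simp: apath_def awalk_def)
  then show "1 \<le> enat (length p)"
    by (cases p) (auto simp: one_enat_def)
qed

lemma graph_dist_ge_2:
  assumes "u \<noteq> v" and "\<not> u \<rightarrow> v"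
  shows "2 \<le> graph_dist G u v"
  unfolding graph_dist_def
proof (rule INF_greatest)
  fix p assume "p \<in> {p. apath u p v}"
  then have p: "awalk u p v"
    by (simp add: apath_def)
  have "p \<noteq> []"
    using p assms(1) by (auto simp: awalk_def)
  moreover have "p \<noteq> [e]" for e
    using p assms(2) by (auto simp: awalk_Cons_iff awalk_Nil_iff dest: in_arcs_imp_in_arcs_ends)
  ultimately have "2 \<le> length p"
    by (cases p; cases "tl p") auto
  then show "2 \<le> enat (length p)"
    by (simp add: numeral_eq_enat)
qed

lemma graph_dist_le_1:
  assumes "u \<noteq> v" and "u \<rightarrow> v"
  shows "graph_dist G u v \<le> 1"
proof -
  obtain e where "e \<in> arcs G" "tail G e = u" "head G e = v"
    using assms(2) by auto
  then have "apath u [e] v"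
    using assms(1) by (auto simp: apath_def awalk_Cons_iff awalk_Nil_iff)
  then have "graph_dist G u v \<le> enat (length [e])"
    unfolding graph_dist_def by (intro INF_lower) simp
  then show ?thesis
    by (simp add: one_enat_def)
qed

lemma graph_dist_le_2:
  assumes "u \<rightarrow> c" and "c \<rightarrow> v" and "u \<noteq> c" and "c \<noteq> v" and "u \<noteq> v"
  shows "graph_dist G u v \<le> 2"
proof -
  obtain e f where "e \<in> arcs G" "tail G e = u" "head G e = c"
    and "f \<in> arcs G" "tail G f = c" "head G f = v"
    using assms(1,2) by (auto simp: arcs_ends_def arc_to_ends_def)
  then have "apath u [e, f] v"
    using assms(3-5) by (auto simp: apath_def awalk_Cons_iff awalk_Nil_iff)
  then have "graph_dist G u v \<le> enat (length [e, f])"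
    unfolding graph_dist_def by (intro INF_lower) simp
  then show ?thesis
    by (simp add: numeral_eq_enat numeral_2_eq_2)
qed

end

context graph
begin

text \<open>Symmetry turns the universal vertex into a midpoint of any two others.\<close>

lemma graph_dist_le_2_if_universal_vertex:
  assumes c: "c \<in> verts G" and univ: "\<And>w. w \<in> verts G \<Longrightarrow> w \<noteq> c \<Longrightarrow> c \<rightarrow> w"
    and "u \<in> verts G" "v \<in> verts G" "u \<noteq> v"
  shows "graph_dist G u v \<le> 2"
proof (cases "u = c \<or> v = c")
  case True
  then have "u \<rightarrow> v"
    using assms by (auto intro: arcs_ends_symmetric[OF sym_arcs])
  then have "graph_dist G u v \<le> 1"
    using \<open>u \<noteq> v\<close> by (rule graph_dist_le_1[rotated])
  also have "(1 :: enat) \<le> 2"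
    by simp
  finally show ?thesis .
next
  case False
  then show ?thesis
    using assms by (intro graph_dist_le_2[of u c v]) (auto intro: arcs_ends_symmetric[OF sym_arcs])
qed

lemma graph_diam_rad_if_universal_vertex:
  assumes c: "c \<in> verts G" and univ: "\<And>w. w \<in> verts G \<Longrightarrow> w \<noteq> c \<Longrightarrow> c \<rightarrow> w"
    and "\<not> complete_graph G"
  shows "graph_diam G = 2" and "graph_rad G = 1"
proof -
  obtain u v where uv: "u \<in> verts G" "v \<in> verts G" "u \<noteq> v" "\<not> u \<rightarrow> v"
    using assms(3) by (auto simp: complete_graph_def)
  have ecc_ge_dist: "graph_dist G x y \<le> eccentricity G x"
    if "y \<in> verts G" "x \<noteq> y" for x y
    unfolding eccentricity_def using that by (intro SUP_upper) auto
  show "graph_diam G = 2"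
  proof (rule antisym)
    show "graph_diam G \<le> 2"
      unfolding graph_diam_def eccentricity_def
      by (intro SUP_least graph_dist_le_2_if_universal_vertex[OF c univ]) auto
    have "2 \<le> graph_dist G u v"
      using uv by (intro graph_dist_ge_2)
    also have "\<dots> \<le> eccentricity G u"
      using uv by (intro ecc_ge_dist)
    also have "\<dots> \<le> graph_diam G"
      unfolding graph_diam_def using uv by (intro SUP_upper)
    finally show "2 \<le> graph_diam G" .
  qed
  show "graph_rad G = 1"
  proof (rule antisym)
    have "graph_rad G \<le> eccentricity G c"
      unfolding graph_rad_def using c by (intro INF_lower)
    also have "\<dots> \<le> 1"
      unfolding eccentricity_def using univ by (intro SUP_least graph_dist_le_1) auto
    finally show "graph_rad G \<le> 1" .
    have "1 \<le> eccentricity G x" for x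
    proof -
      obtain y where y: "y \<in> verts G" "x \<noteq> y"
        using uv by metis
      have "1 \<le> graph_dist G x y"
        using y by (intro graph_dist_ge_1)
      also have "\<dots> \<le> eccentricity G x"
        using y by (intro ecc_ge_dist)
      finally show ?thesis .
    qed
    then show "1 \<le> graph_rad G"
      unfolding graph_rad_def by (intro INF_greatest)
  qed
qed

end

theorem theorem4p5:
  fixes R :: "('a, 'b) ring_scheme"
  assumes "cring R" and "finite (carrier R)"
    and "\<not> complete_graph (unity_product_graph_compl R)"
  shows "graph_diam (unity_product_graph_compl R) = 2 \<and>
         graph_rad (unity_product_graph_compl R) = 1"
proof -
  interpret cring R by fact
  interpret G: graph "unity_product_graph_compl R"
    using assms(1,2) by (rule graph_unity_product_graph_compl)
  have one: "\<one>\<^bsub>R\<^esub> \<in> verts (unity_product_graph_compl R)"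
    by (simp add: unity_product_graph_compl_def)
  have "\<one>\<^bsub>R\<^esub> \<rightarrow>\<^bsub>unity_product_graph_compl R\<^esub> r"
    if "r \<in> verts (unity_product_graph_compl R)" "r \<noteq> \<one>\<^bsub>R\<^esub>" for r
    using that by (auto simp: unity_product_graph_compl_def arcs_ends_def arc_to_ends_def Units_closed)
  with one assms(3) show ?thesis
    by (blast intro: G.graph_diam_rad_if_universal_vertex)
qed

end
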